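(* Let $r\ge 2$, let $x_1,\dots,x_r\in\mathbb{C}$, and let $\ell_0,\dots,\ell_{r-1}\in\mathbb{C}$ (the values at $(x_1,\dots,x_r)$ of arbitrary polynomials in $\mathbb{Q}[x_1,\dots,x_r]$). Define $\mathcal{F}^{[r]}_n=\ell_n$ for $0\le n\le r-1$ and $\mathcal{F}^{[r]}_n=\sum_{i=1}^r x_i\mathcal{F}^{[r]}_{n-i}$ for $n\ge r$. Suppose the polynomial $z^r-x_1z^{r-1}-\cdots-x_{r-1}z-x_r$ has $r$ distinct roots $\lambda_1,\dots,\lambda_r$. For $1\le i\le r$ define $$\sigma_{i,1}=\Big(\prod_{\substack{1\le m\le r\\ m\ne i}}(\lambda_i-\lambda_m)\Big)^{-1},\qquad \sigma_{i,j}=(-1)^{r-j}\,\frac{\displaystyle\sum_{\substack{1\le m_1<\cdots<m_{j-1}\le r\\ m_1,\dots,m_{j-1}\ne i}}\lambda_{m_1}\cdots\lambda_{m_{j-1}}}{\displaystyle\prod_{\substack{1\le m\le r\\ m\ne i}}(\lambda_m-\lambda_i)}\quad(1<j\le r).$$ Then for every integer $n\ge 0$ (with the convention $0^0=1$), $$\mathcal{F}^{[r]}_n=\sum_{i=1}^r\Big(\lambda_i^{\,n}\sum_{j=1}^r\sigma_{i,j}\,\ell_{r-j}\Big).$$ *)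

theory Defs
  imports Complex_Main "HOL-Computational_Algebra.Polynomial"
begin

text \<open>
  The data \<open>x\<^sub>1, \<dots>, x\<^sub>r\<close>, \<open>l\<^sub>0, \<dots>, l\<^bsub>r-1\<^esub>\<close> and \<open>lam\<^sub>1, \<dots>, lam\<^sub>r\<close> are functions on \<open>nat\<close>; values
  outside the index ranges \<open>{1..r}\<close>, \<open>{..<r}\<close> and \<open>{1..r}\<close> are never used.
\<close>

function gen_fib :: "nat \<Rightarrow> (nat \<Rightarrow> complex) \<Rightarrow> (nat \<Rightarrow> complex) \<Rightarrow> nat \<Rightarrow> complex" where
  "gen_fib r x l n =
     (if n < r then l n else (\<Sum>i\<in>{1..r}. x i * gen_fib r x l (n - i)))"
  by pat_completeness auto
termination
  by (relation "measure (\<lambda>(r, x, l, n). n)") auto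

text \<open>The unguarded defining equation would make the simplifier loop.\<close>
declare gen_fib.simps [simp del]

definition gen_fib_poly :: "nat \<Rightarrow> (nat \<Rightarrow> complex) \<Rightarrow> complex poly" where
  "gen_fib_poly r x = monom 1 r - (\<Sum>i\<in>{1..r}. monom (x i) (r - i))"

text \<open>
  A choice of indices \<open>m\<^sub>1 < \<dots> < m\<^bsub>k\<^esub>\<close> in \<open>{1..r}\<close>, all different from \<open>i\<close>, is encoded as the
  \<open>k\<close>-element set \<open>M = {m\<^sub>1, \<dots>, m\<^bsub>k\<^esub>}\<close>.
\<close>

definition esym_omit :: "nat \<Rightarrow> (nat \<Rightarrow> complex) \<Rightarrow> nat \<Rightarrow> nat \<Rightarrow> complex" where
  "esym_omit r lam i k =
     (\<Sum>M\<in>{M. M \<subseteq> {1..r} - {i} \<and> card M = k}. \<Prod>m\<in>M. lam m)"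

definition binet_coeff :: "nat \<Rightarrow> (nat \<Rightarrow> complex) \<Rightarrow> nat \<Rightarrow> nat \<Rightarrow> complex" where
  "binet_coeff r lam i j =
     (if j = 1 then inverse (\<Prod>m\<in>{1..r} - {i}. lam i - lam m)
      else (-1) ^ (r - j) * (esym_omit r lam i (j - 1) / (\<Prod>m\<in>{1..r} - {i}. lam m - lam i)))"

end

theory Submission
  imports Defs
begin

text \<open>
  The right-hand side satisfies the recurrence because every \<open>lam i\<close> is a root of the characteristic
  polynomial. For the initial values, \<open>binet_coeff r lam i j\<close> is the coefficient of \<open>z ^ (r - j)\<close> in
  the Lagrange basis polynomial of the node \<open>lam i\<close>, and interpolation reproduces \<open>z ^ n\<close>
  whenever \<open>n < r\<close>.
\<close>

text \<open>Vieta's formula. Expand the product by choosing the set \<open>M\<close> of factors that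
  contribute their constant \<open>- a m\<close>; the others contribute \<open>z\<close>, so
  \<open>M\<close> yields a monomial of degree \<open>card A - card M\<close>.\<close>

lemma coeff_prod_linear_factors:
  fixes a :: "'i \<Rightarrow> 'a :: comm_ring_1"
  assumes "finite A" and "k \<le> card A"
  shows "coeff (\<Prod>m\<in>A. [:- a m, 1:]) (card A - k) =
    (-1) ^ k * (\<Sum>M\<in>{M. M \<subseteq> A \<and> card M = k}. \<Prod>m\<in>M. a m)"
proof -
  have "(\<Prod>m\<in>A. [:- a m, 1:]) = (\<Prod>m\<in>A. [:- a m:] + monom 1 1)"
    by (simp add: monom_altdef)
  also have "\<dots> = (\<Sum>M\<in>Pow A. (\<Prod>m\<in>M. [:- a m:]) * (\<Prod>m\<in>A - M. monom 1 1))"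
    using assms(1) by (rule prod_add)
  also have "\<dots> = (\<Sum>M\<in>Pow A. monom ((-1) ^ card M * (\<Prod>m\<in>M. a m)) (card A - card M))"
  proof (rule sum.cong[OF refl])
    fix M assume "M \<in> Pow A"
    then have M: "finite M" "card (A - M) = card A - card M"
      using assms(1) by (auto simp: card_Diff_subset finite_subset)
    have "(\<Prod>m\<in>M. [:- a m:]) = [:(-1) ^ card M * (\<Prod>m\<in>M. a m):]"
      using M(1) by (induction M) (auto simp: algebra_simps)
    then show "(\<Prod>m\<in>M. [:- a m:]) * (\<Prod>m\<in>A - M. monom 1 1) =
        monom ((-1) ^ card M * (\<Prod>m\<in>M. a m)) (card A - card M)"
      by (simp add: M(2) monom_power smult_monom)
  qed
  finally have "coeff (\<Prod>m\<in>A. [:- a m, 1:]) (card A - k) =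
      (\<Sum>M\<in>Pow A. if card A - card M = card A - k
        then (-1) ^ card M * (\<Prod>m\<in>M. a m) else 0)"
    by (simp add: coeff_sum)
  also have "\<dots> = (\<Sum>M\<in>{M. M \<subseteq> A \<and> card M = k}. (-1) ^ k * (\<Prod>m\<in>M. a m))"
  proof (rule sum.mono_neutral_cong_right)
    show "\<forall>M\<in>Pow A - {M. M \<subseteq> A \<and> card M = k}.
        (if card A - card M = card A - k then (-1) ^ card M * (\<Prod>m\<in>M. a m) else 0) = 0"
    proof
      fix M assume M: "M \<in> Pow A - {M. M \<subseteq> A \<and> card M = k}"
      then have "card M \<le> card A" using assms(1) by (auto intro: card_mono)
      \<comment> \<open>Both \<open>card M\<close> and \<open>k\<close> are at most
        \<open>card A\<close>, so truncated subtraction cannot identify different values.\<close>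
      with M assms(2) have "card A - card M \<noteq> card A - k" by auto
      then show "(if card A - card M = card A - k
          then (-1) ^ card M * (\<Prod>m\<in>M. a m) else 0) = 0" by simp
    qed
  qed (use assms in auto)
  finally show ?thesis by (simp add: sum_distrib_left)
qed

text \<open>Vieta's formula for the nodes other than \<open>lam i\<close>, with the signs of the two
  cases of \<open>binet_coeff\<close> reconciled.\<close>

lemma binet_coeff_eq_coeff:
  assumes "i \<in> {1..r}" and "k < r"
  shows "binet_coeff r lam i (r - k) =
    coeff (\<Prod>m\<in>{1..r} - {i}. [:- lam m, 1:]) k / (\<Prod>m\<in>{1..r} - {i}. lam i - lam m)"
proof -
  let ?A = "{1..r} - {i}"
  \<comment> \<open>The degree of the symmetric function, one less than the index
    \<open>r - k\<close> of \<open>binet_coeff\<close>.\<close>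
  define j where "j = r - k - 1"
  have A: "finite ?A" "card ?A = r - 1" "j \<le> card ?A" "card ?A - j = k" "r - k = Suc j" "k + j = r - 1"
    using assms by (auto simp: j_def)
  have coeff: "coeff (\<Prod>m\<in>?A. [:- lam m, 1:]) k = (-1) ^ j * esym_omit r lam i j"
    using coeff_prod_linear_factors[OF A(1,3), of lam] by (simp only: A(4) esym_omit_def)
  show ?thesis
  proof (cases "j = 0")
    case True
    have "M \<subseteq> ?A \<and> card M = 0 \<longleftrightarrow> M = {}" for M
      using A(1) by (metis card_eq_0_iff empty_subsetI finite_subset)
    then have "esym_omit r lam i 0 = 1" by (simp add: esym_omit_def)
    with True show ?thesis
      unfolding A(5) coeff by (simp add: binet_coeff_def inverse_eq_divide)
  next
    case False
    \<comment> \<open>Reversing all \<open>r - 1 = k + j\<close> differences turns the sign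
      \<open>(-1) ^ k\<close> of \<open>binet_coeff\<close> into the \<open>(-1) ^ j\<close> of
      Vieta's formula.\<close>
    have P: "(\<Prod>m\<in>?A. lam m - lam i) = (-1) ^ (k + j) * (\<Prod>m\<in>?A. lam i - lam m)"
      by (subst prod_diff_swap) (simp only: A(2,6))
    have "r - Suc j = k" using A(5) assms(2) by simp
    with False show ?thesis
      unfolding A(5) coeff binet_coeff_def P
      by (simp add: power_add minus_one_power_iff)
  qed
qed

text \<open>Both sides have degree below \<open>card A\<close> and agree at the
  \<open>card A\<close> distinct nodes, hence are equal.\<close>

lemma poly_lagrange_expansion:
  fixes lam :: "'i \<Rightarrow> 'a :: field"
  assumes "finite A" and "inj_on lam A" and "degree p < card A"
  shows "p = (\<Sum>i\<in>A. smult (poly p (lam i) / (\<Prod>m\<in>A - {i}. lam i - lam m))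
    (\<Prod>m\<in>A - {i}. [:- lam m, 1:]))" (is "p = ?q")
proof (rule poly_eqI_degree[where A = "lam ` A"])
  have card: "card (lam ` A) = card A" using assms(2) by (rule card_image)
  show "card (lam ` A) > degree p" using assms(3) card by simp
  have "degree ?q \<le> card A - 1"
  proof (rule degree_sum_le[OF assms(1)])
    fix i assume "i \<in> A"
    have "degree (\<Prod>m\<in>A - {i}. [:- lam m, 1:]) \<le> (\<Sum>m\<in>A - {i}. degree [:- lam m, 1:])"
      using degree_prod_sum_le[of "A - {i}" "\<lambda>m. [:- lam m, 1:]"] assms(1) by (simp add: o_def)
    also have "\<dots> = card A - 1" using \<open>i \<in> A\<close> assms(1) by simp
    finally show "degree (smult (poly p (lam i) / (\<Prod>m\<in>A - {i}. lam i - lam m))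
        (\<Prod>m\<in>A - {i}. [:- lam m, 1:])) \<le> card A - 1"
      by (meson degree_smult_le le_trans)
  qed
  then show "card (lam ` A) > degree ?q" using assms(3) card by simp
next
  fix z assume "z \<in> lam ` A"
  then obtain k where k: "k \<in> A" "z = lam k" by auto
  have nz: "(\<Prod>m\<in>A - {k}. lam k - lam m) \<noteq> 0"
    using assms(1,2) k(1) by (auto simp: inj_on_def)
  have "poly ?q z = (\<Sum>i\<in>A. if i = k then poly p z else 0)"
    unfolding poly_sum
  proof (rule sum.cong[OF refl])
    fix i assume "i \<in> A"
    show "poly (smult (poly p (lam i) / (\<Prod>m\<in>A - {i}. lam i - lam m))
        (\<Prod>m\<in>A - {i}. [:- lam m, 1:])) z = (if i = k then poly p z else 0)"
    proof (cases "i = k")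
      case True
      then show ?thesis using nz k(2) by (simp add: poly_prod)
    next
      case False
      \<comment> \<open>The factor \<open>m = k\<close> vanishes, since
        \<open>z = lam k\<close>.\<close>
      then have "(\<Prod>m\<in>A - {i}. z - lam m) = 0"
        using assms(1) k by (intro prod_zero) auto
      with False show ?thesis by (simp add: poly_prod)
    qed
  qed
  then show "poly p z = poly ?q z" using assms(1) k(1) by simp
qed

text \<open>Compare the coefficients of \<open>z ^ k\<close> in the Lagrange expansion of
  \<open>z ^ n\<close>. This orthogonality isolates \<open>l n\<close> among the initial
  values.\<close>

lemma sum_power_binet_coeff:
  assumes "inj_on lam {1..r}" and "n < r" and "k < r"
  shows "(\<Sum>i\<in>{1..r}. lam i ^ n * binet_coeff r lam i (r - k)) = (if k = n then 1 else 0)"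
proof -
  have "coeff (monom 1 n :: complex poly) k = (\<Sum>i\<in>{1..r}.
      lam i ^ n / (\<Prod>m\<in>{1..r} - {i}. lam i - lam m) *
      coeff (\<Prod>m\<in>{1..r} - {i}. [:- lam m, 1:]) k)"
    using arg_cong[OF poly_lagrange_expansion[of "{1..r}" lam "monom 1 n"], of "\<lambda>p. coeff p k"] assms
    by (simp add: degree_monom_eq coeff_sum poly_monom)
  also have "\<dots> = (\<Sum>i\<in>{1..r}. lam i ^ n * binet_coeff r lam i (r - k))"
    by (intro sum.cong) (simp_all add: binet_coeff_eq_coeff assms(3))
  finally show ?thesis by auto
qed

text \<open>Multiply the characteristic equation by \<open>z ^ (n - r)\<close>; the exponents
  combine because \<open>i \<le> r \<le> n\<close>.\<close>

lemma root_gen_fib_poly_power: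
  assumes "poly (gen_fib_poly r x) z = 0" and "r \<le> n"
  shows "z ^ n = (\<Sum>i\<in>{1..r}. x i * z ^ (n - i))"
proof -
  have "z ^ r = (\<Sum>i\<in>{1..r}. x i * z ^ (r - i))"
    using assms(1) by (simp add: gen_fib_poly_def poly_sum poly_monom)
  then have "z ^ (n - r) * z ^ r = (\<Sum>i\<in>{1..r}. x i * (z ^ (n - r) * z ^ (r - i)))"
    by (simp add: sum_distrib_left mult.left_commute)
  with assms(2) show ?thesis by (simp flip: power_add)
qed

theorem theorem2p3:
  fixes r :: nat
    and x l lam :: "nat \<Rightarrow> complex"
    and n :: nat
  assumes "r \<ge> 2"
    and "inj_on lam {1..r}"
    and "\<And>i. i \<in> {1..r} \<Longrightarrow> poly (gen_fib_poly r x) (lam i) = 0"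
  shows "gen_fib r x l n =
    (\<Sum>i\<in>{1..r}. lam i ^ n * (\<Sum>j\<in>{1..r}. binet_coeff r lam i j * l (r - j)))"
proof (induction n rule: less_induct)
  case (less n)
  define c where "c i = (\<Sum>j\<in>{1..r}. binet_coeff r lam i j * l (r - j))" for i
  show ?case
  proof (cases "n < r")
    case True
    have c: "c i = (\<Sum>k<r. binet_coeff r lam i (r - k) * l k)" for i
      unfolding c_def
      \<comment> \<open>The substitution \<open>k = r - j\<close> makes the sum run over the initial
        values.\<close>
      by (rule sum.reindex_bij_witness[of _ "\<lambda>k. r - k" "\<lambda>j. r - j"]) auto
    have "(\<Sum>i\<in>{1..r}. lam i ^ n * c i) =
        (\<Sum>k<r. (\<Sum>i\<in>{1..r}. lam i ^ n * binet_coeff r lam i (r - k)) * l k)"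
      unfolding c sum_distrib_left sum_distrib_right
      by (subst sum.swap) (simp add: mult.assoc)
    also have "\<dots> = (\<Sum>k<r. if k = n then l k else 0)"
      by (intro sum.cong) (use sum_power_binet_coeff[OF assms(2) True] in simp_all)
    also have "\<dots> = gen_fib r x l n"
      using True by (simp add: gen_fib.simps)
    finally show ?thesis by (simp add: c_def)
  next
    case False
    have "gen_fib r x l n = (\<Sum>k\<in>{1..r}. x k * gen_fib r x l (n - k))"
      using False by (simp add: gen_fib.simps[of r x l n])
    also have "\<dots> = (\<Sum>k\<in>{1..r}. x k * (\<Sum>i\<in>{1..r}. lam i ^ (n - k) * c i))"
      \<comment> \<open>The induction hypothesis applies at \<open>n - k\<close>, which is below
        \<open>n\<close> because \<open>k \<ge> 1\<close> and \<open>n \<ge> r > 0\<close>.\<close>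
      using False assms(1) less by (intro sum.cong) (simp_all add: c_def)
    \<comment> \<open>As \<open>c i\<close> does not depend on \<open>k\<close>, swapping the sums
      leaves the recurrence for the powers of each single root.\<close>
    also have "\<dots> = (\<Sum>i\<in>{1..r}. (\<Sum>k\<in>{1..r}. x k * lam i ^ (n - k)) * c i)"
      unfolding sum_distrib_left sum_distrib_right
      by (subst sum.swap) (simp add: mult.assoc)
    also have "\<dots> = (\<Sum>i\<in>{1..r}. lam i ^ n * c i)"
      using root_gen_fib_poly_power[OF assms(3), of _ n] False by (intro sum.cong) simp_all
    finally show ?thesis by (simp add: c_def)
  qed
qed

end
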